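(* Let $r>0$, let $\mathbf{k}=(k_1,\ldots,k_{r-1};k_r)$ with all $k_i\in\mathbb{N}$, and let $\sigma\in\mathfrak{S}_r$. Then $$\pi\big((M^{(\mathbf{k})}-M^{(\sigma(\mathbf{k}))})x_1\big)\in\operatorname{Ker}\mathrm{Li}^-_\bullet,$$ where $\sigma(\mathbf{k}):=(k_{\sigma(1)},\ldots,k_{\sigma(r-1)};k_{\sigma(r)})$.
   Context: $\mathbb{N}$ is the set of non-negative integers. For $\mathbf{s}=(s_1,\ldots,s_m)\in\mathbb{N}^m$ put $\mathrm{Li}^-_{\mathbf{s}}(z):=\sum_{n_1>\cdots>n_m>0}n_1^{s_1}\cdots n_m^{s_m}z^{n_1}$ for $|z|<1$ (empty index gives $1$), a rational function in $\mathbb{C}[z,(1-z)^{-1}]$. Let $\mathbb{C}\langle Y\rangle$ be the free associative $\mathbb{C}$-algebra on $Y=\{y_0,y_1,\ldots\}$ and $\mathrm{Li}^-_\bullet:\mathbb{C}\langle Y\rangle\to\mathbb{C}[z,(1-z)^{-1}]$ the $\mathbb{C}$-linear map with $y_{s_1}\cdots y_{s_m}\mapsto\mathrm{Li}^-_{(s_1,\ldots,s_m)}$. Let $\pi:\mathbb{C}\langle x_0,x_1\rangle x_1\to\mathbb{C}\langle Y\rangle$ be the linear isomorphism from the span of words in $x_0,x_1$ ending in $x_1$, $x_0^{s_1}x_1\cdots x_0^{s_m}x_1\mapsto y_{s_1}\cdots y_{s_m}$. Define $x_1^{(0)}:=x_1$, $x_1^{(n)}:=x_0x_1^{(n-1)}-x_1^{(n-1)}x_0$,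 and the Magnus polynomial $M^{(k_1,\ldots,k_{r-1};k_r)}:=x_1^{(k_1)}\cdots x_1^{(k_{r-1})}x_0^{k_r}$. *)

theory Defs
  imports "HOL-Analysis.Analysis" "HOL-Combinatorics.Permutations" "HOL-Library.Poly_Mapping"
begin

text \<open>
  Lists under concatenation form the free monoid. Via the convolution product of
  \<^theory>\<open>HOL-Library.Poly_Mapping\<close>, the type \<open>'a list \<Rightarrow>\<^sub>0 complex\<close> is then the free associative
  \<open>\<complex>\<close>-algebra on the letters \<open>'a\<close>.
\<close>

instantiation list :: (type) monoid_add
begin

definition zero_list :: "'a list" where "zero_list = []"

definition plus_list :: "'a list \<Rightarrow> 'a list \<Rightarrow> 'a list" where "plus_list = (@)"

instance by standard (simp_all add: zero_list_def plus_list_def)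

end

datatype xletter = X0 | X1

type_synonym xalg = "xletter list \<Rightarrow>\<^sub>0 complex"

text \<open>The letter \<open>y\<^sub>s\<close> is represented by the natural number \<open>s\<close>.\<close>

type_synonym yalg = "nat list \<Rightarrow>\<^sub>0 complex"

definition x0 :: xalg where "x0 = Poly_Mapping.single [X0] 1"

definition x1 :: xalg where "x1 = Poly_Mapping.single [X1] 1"

lemma single_mult_single_list:
  "Poly_Mapping.single u a * Poly_Mapping.single v b = Poly_Mapping.single (u @ v) (a * b :: complex)"
  by (simp add: mult_single plus_list_def)

fun x1_iter :: "nat \<Rightarrow> xalg" where
  "x1_iter 0 = x1"
| "x1_iter (Suc n) = x0 * x1_iter n - x1_iter n * x0"

text \<open>The index \<open>(k\<^sub>1, \<dots>, k\<^sub>r\<^sub>-\<^sub>1; k\<^sub>r)\<close> is given by \<open>r\<close> and the values of \<open>k\<close> on \<open>{1..r}\<close>.\<close>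

definition magnus :: "nat \<Rightarrow> (nat \<Rightarrow> nat) \<Rightarrow> xalg" where
  "magnus r k = prod_list (map (\<lambda>i. x1_iter (k i)) [1..<r]) * x0 ^ k r"

text \<open>
  \<open>ywords n w\<close> reads off the exponents of \<open>x\<^sub>0\<^sup>n w\<close>, so \<open>ywords 0\<close> is the map
  \<open>x\<^sub>0\<^sup>s\<^sup>1 x\<^sub>1 \<cdots> x\<^sub>0\<^sup>s\<^sup>m x\<^sub>1 \<mapsto> y\<^sub>s\<^sub>1 \<cdots> y\<^sub>s\<^sub>m\<close>; its values on words not ending in \<open>x\<^sub>1\<close> are immaterial.
\<close>

fun ywords :: "nat \<Rightarrow> xletter list \<Rightarrow> nat list" where
  "ywords n [] = []"
| "ywords n (X0 # w) = ywords (Suc n) w"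
| "ywords n (X1 # w) = n # ywords 0 w"

lemma ywords_replicate: "ywords n (replicate s X0 @ w) = ywords (n + s) w"
  by (induction s arbitrary: n) auto

lemma ywords_xword: "ywords 0 (concat (map (\<lambda>s. replicate s X0 @ [X1]) ss)) = ss"
  by (induction ss) (auto simp: ywords_replicate)

lemma xword_ywords:
  "w \<noteq> [] \<Longrightarrow> last w = X1 \<Longrightarrow>
    concat (map (\<lambda>s. replicate s X0 @ [X1]) (ywords n w)) = replicate n X0 @ w"
proof (induction n w rule: ywords.induct)
  case (2 n w)
  then show ?case by (cases "w = []") (auto simp: replicate_app_Cons_same)
next
  case (3 n w)
  then show ?case by (cases "w = []") auto
qed simp

text \<open>The linear map \<open>\<pi>\<close>, to be applied to elements of \<open>\<complex>\<langle>x\<^sub>0,x\<^sub>1\<rangle>x\<^sub>1\<close>.\<close>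

definition pi_Y :: "xalg \<Rightarrow> yalg" where
  "pi_Y p = (\<Sum>w\<in>Poly_Mapping.keys p.
     Poly_Mapping.single (ywords 0 w) (Poly_Mapping.lookup p w))"

lemma pi_Y_xword:
  "pi_Y (Poly_Mapping.single (concat (map (\<lambda>s. replicate s X0 @ [X1]) ss)) c)
     = Poly_Mapping.single ss c"
  by (simp add: pi_Y_def ywords_xword)

lemma pi_Y_add: "pi_Y (p + q) = pi_Y p + pi_Y q"
proof -
  have *: "pi_Y u = (\<Sum>w\<in>A. Poly_Mapping.single (ywords 0 w) (Poly_Mapping.lookup u w))"
    if "finite A" "Poly_Mapping.keys u \<subseteq> A" for A and u :: xalg
    unfolding pi_Y_def using that
    by (intro sum.mono_neutral_left) (auto simp: in_keys_iff)
  let ?A = "Poly_Mapping.keys p \<union> Poly_Mapping.keys q"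
  have "Poly_Mapping.keys (p + q) \<subseteq> ?A"
    by (rule Poly_Mapping.keys_add)
  then show ?thesis
    by (simp add: *[of ?A] lookup_add single_add sum.distrib)
qed

definition index_tuples :: "nat \<Rightarrow> nat list set" where
  "index_tuples m = {ns. length ns = m \<and> sorted_wrt (>) ns \<and> 0 \<notin> set ns}"

definition Li_neg :: "nat list \<Rightarrow> complex \<Rightarrow> complex" where
  "Li_neg s z = (if s = [] then 1 else
     (\<Sum>\<^sub>\<infinity>ns\<in>index_tuples (length s).
        (\<Prod>i<length s. of_nat (ns ! i) ^ (s ! i)) * z ^ hd ns))"

definition Li_neg_map :: "yalg \<Rightarrow> complex \<Rightarrow> complex" where
  "Li_neg_map p z = (\<Sum>s\<in>Poly_Mapping.keys p. Poly_Mapping.lookup p s * Li_neg s z)"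

text \<open>
  An element of \<open>\<complex>[z,(1-z)\<^sup>-\<^sup>1]\<close> is identified with the function it defines on the open unit disc,
  where the series converge; it is zero iff that function vanishes.
\<close>

definition Ker_Li_neg :: "yalg set" where
  "Ker_Li_neg = {p. \<forall>z\<in>ball 0 1. Li_neg_map p z = 0}"

end

theory Submission
  imports Defs
begin

text \<open>
  Let \<open>\<theta> = z d/dz\<close> and \<open>\<lambda> = z/(1-z)\<close>. Letting \<open>x\<^sub>0\<close> act as \<open>\<theta>\<close> and \<open>x\<^sub>1\<close> as multiplication by
  \<open>\<lambda>\<close> makes the power series a module over \<open>\<complex>\<langle>x\<^sub>0,x\<^sub>1\<rangle>\<close>, and the word that \<open>\<pi>\<close> sends to \<open>y\<^sub>s\<close>
  maps \<open>1\<close> to \<open>Li\<^sup>-\<^sub>s\<close>. Since \<open>\<theta>\<close> is a derivation, the commutator \<open>x\<^sub>1\<^sup>(\<^sup>n\<^sup>)\<close> acts as multiplication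
  by \<open>\<theta>\<^sup>n \<lambda>\<close>. Hence \<open>M\<^sup>(\<^sup>k\<^sup>) x\<^sub>1\<close> sends \<open>1\<close> to \<open>\<theta>\<^sup>k\<^sup>1 \<lambda> \<cdots> \<theta>\<^sup>k\<^sup>r \<lambda>\<close>, a product of commuting factors.
\<close>

section \<open>Actions of free algebras\<close>

lemma poly_mapping_sum_single:
  "(\<Sum>w\<in>Poly_Mapping.keys p. Poly_Mapping.single w (Poly_Mapping.lookup p w)) = p"
  by (rule poly_mapping_eqI) (auto simp: lookup_sum lookup_single when_def in_keys_iff)

text \<open>
  A locale of its own, because additions to \<^locale>\<open>module\<close> would be shadowed by its unqualified
  interpretation for real vector spaces.
\<close>

locale free_module_extension = module scale
  for scale :: "'k::comm_ring_1 \<Rightarrow> 'v::ab_group_add \<Rightarrow> 'v" (infixr \<open>\<cdot>\<close> 75)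
begin

definition linear_extension :: "('b \<Rightarrow> 'v) \<Rightarrow> ('b \<Rightarrow>\<^sub>0 'k) \<Rightarrow> 'v" where
  "linear_extension \<phi> p = (\<Sum>w\<in>Poly_Mapping.keys p. Poly_Mapping.lookup p w \<cdot> \<phi> w)"

lemma linear_extension_single: "linear_extension \<phi> (Poly_Mapping.single w c) = c \<cdot> \<phi> w"
  by (simp add: linear_extension_def)

lemma additive_linear_extension: "Modules.additive (linear_extension \<phi>)"
  unfolding linear_extension_def
  by (intro Modules.additive.intro setsum_keys_plus_distrib) (simp_all add: scale_left_distrib)

lemmas linear_extension_diff = Modules.additive.diff [OF additive_linear_extension]
lemmas linear_extension_sum = Modules.additive.sum [OF additive_linear_extension]

lemma linear_extension_mult_single:
  fixes p :: "'b::monoid_add \<Rightarrow>\<^sub>0 'k"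
  shows "linear_extension \<phi> (p * Poly_Mapping.single v 1) = linear_extension (\<lambda>w. \<phi> (w + v)) p"
proof -
  have "p * Poly_Mapping.single v 1 =
      (\<Sum>w\<in>Poly_Mapping.keys p. Poly_Mapping.single (w + v) (Poly_Mapping.lookup p w))"
    by (subst (1) poly_mapping_sum_single [of p, symmetric]) (simp add: sum_distrib_right mult_single)
  then show ?thesis
    by (simp only: linear_extension_sum linear_extension_single) (simp add: linear_extension_def)
qed

end

locale free_algebra_action = free_module_extension scale
  for scale :: "'k::comm_ring_1 \<Rightarrow> 'v::ab_group_add \<Rightarrow> 'v" (infixr \<open>\<cdot>\<close> 75) +
  fixes letter_act :: "'a \<Rightarrow> 'v \<Rightarrow> 'v"
  assumes module_hom_letter_act: "module_hom scale scale (letter_act a)"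
begin

definition word_act :: "'a list \<Rightarrow> 'v \<Rightarrow> 'v" where
  "word_act w = foldr letter_act w"

lemma word_act_Nil [simp]: "word_act [] v = v"
  and word_act_Cons [simp]: "word_act (a # w) v = letter_act a (word_act w v)"
  and word_act_append: "word_act (u @ w) v = word_act u (word_act w v)"
  by (simp_all add: word_act_def)

lemma module_hom_word_act: "module_hom scale scale (word_act w)"
proof (induction w)
  case Nil
  show ?case by (simp add: module_hom_iff module_axioms)
next
  case (Cons a w)
  then show ?case
    using module_hom_letter_act [of a] by (simp add: module_hom_iff)
qed

definition alg_act :: "('a list \<Rightarrow>\<^sub>0 'k) \<Rightarrow> 'v \<Rightarrow> 'v" where
  "alg_act p v = linear_extension (\<lambda>w. word_act w v) p"

lemma alg_act_diff: "alg_act (p - q) v = alg_act p v - alg_act q v"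
  by (simp add: alg_act_def linear_extension_diff)

lemma alg_act_single: "alg_act (Poly_Mapping.single w c) v = c \<cdot> word_act w v"
  by (simp add: alg_act_def linear_extension_single)

lemma alg_act_one: "alg_act 1 v = v"
  by (simp add: alg_act_single zero_list_def flip: single_one)

lemma alg_act_mult: "alg_act (p * q) v = alg_act p (alg_act q v)"
proof -
  let ?l = Poly_Mapping.lookup
  have "p * q = (\<Sum>u\<in>Poly_Mapping.keys p. \<Sum>w\<in>Poly_Mapping.keys q.
      Poly_Mapping.single (u @ w) (?l p u * ?l q w))"
    by (subst (1) poly_mapping_sum_single [of p, symmetric],
        subst (1) poly_mapping_sum_single [of q, symmetric])
      (simp add: sum_product mult_single plus_list_def)
  then have "alg_act (p * q) v = (\<Sum>u\<in>Poly_Mapping.keys p. \<Sum>w\<in>Poly_Mapping.keys q.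
      (?l p u * ?l q w) \<cdot> word_act u (word_act w v))"
    by (simp add: alg_act_def linear_extension_sum linear_extension_single word_act_append)
  also have "\<dots> = alg_act p (alg_act q v)"
    by (simp add: alg_act_def linear_extension_def scale_sum_right
        module_hom.sum [OF module_hom_word_act] module_hom.scale [OF module_hom_word_act])
  finally show ?thesis .
qed

end

section \<open>Magnus polynomials in a differential algebra\<close>

locale differential_algebra = module scale
  for scale :: "complex \<Rightarrow> 'v::comm_ring_1 \<Rightarrow> 'v" (infixr \<open>\<cdot>\<close> 75) +
  fixes D :: "'v \<Rightarrow> 'v" and u :: 'v
  assumes mult_scale_right: "f * (c \<cdot> g) = c \<cdot> (f * g)"
    and module_hom_D: "module_hom scale scale D"
    and D_mult: "D (f * g) = D f * g + f * D g"
begin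

sublocale free_algebra_action scale "case_xletter D ((*) u)"
  by standard
    (simp_all add: module_hom.add [OF module_hom_D] module_hom.scale [OF module_hom_D]
      mult_scale_right distrib_left split: xletter.split)

lemma alg_act_x0: "alg_act x0 f = D f"
  by (simp add: x0_def alg_act_single)

lemma alg_act_x0_power: "alg_act (x0 ^ n) f = (D ^^ n) f"
  by (induction n) (simp_all add: alg_act_one alg_act_mult alg_act_x0)

lemma alg_act_x1_iter: "alg_act (x1_iter n) f = (D ^^ n) u * f"
proof (induction n arbitrary: f)
  case 0
  show ?case by (simp add: x1_def alg_act_single)
next
  case (Suc n)
  have "alg_act (x1_iter (Suc n)) f = D ((D ^^ n) u * f) - (D ^^ n) u * D f"
    by (simp add: alg_act_diff alg_act_mult alg_act_x0 Suc.IH)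
  also have "\<dots> = (D ^^ Suc n) u * f"
    by (simp add: D_mult)
  finally show ?case .
qed

lemma alg_act_prod_list_x1_iter:
  "alg_act (prod_list (map (\<lambda>i. x1_iter (k i)) xs)) f = prod_list (map (\<lambda>i. (D ^^ k i) u) xs) * f"
  by (induction xs) (simp_all add: alg_act_one alg_act_mult alg_act_x1_iter mult.assoc)

lemma alg_act_magnus:
  assumes "r > 0"
  shows "alg_act (magnus r k) u = (\<Prod>i\<in>{1..r}. (D ^^ k i) u)"
proof -
  have "alg_act (magnus r k) u = (\<Prod>i\<in>{1..<r}. (D ^^ k i) u) * (D ^^ k r) u"
    by (simp add: magnus_def alg_act_mult alg_act_x0_power alg_act_prod_list_x1_iter
        flip: prod.distinct_set_conv_list)
  also have "\<dots> = (\<Prod>i\<in>{1..r}. (D ^^ k i) u)"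
    using assms by (subst prod.last_plus) (auto simp: mult.commute)
  finally show ?thesis .
qed

lemma alg_act_magnus_permute:
  assumes "r > 0" and "\<sigma> permutes {1..r}"
  shows "alg_act (magnus r (k \<circ> \<sigma>)) u = alg_act (magnus r k) u"
  using prod.permute [OF assms(2), of "\<lambda>i. (D ^^ k i) u"]
  by (simp add: alg_act_magnus [OF assms(1)] o_def)

end

section \<open>Power series of the polylogarithms\<close>

definition euler_op :: "'a::comm_semiring_1 fps \<Rightarrow> 'a fps" where
  "euler_op f = fps_X * fps_deriv f"

definition lambda_fps :: "'a::field fps" where
  "lambda_fps = fps_X / (1 - fps_X)"

interpretation euler: differential_algebra "\<lambda>c f. fps_const c * f" euler_op lambda_fps
proof -
  interpret module "\<lambda>c f. fps_const (c::complex) * f"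
    by standard (simp_all add: algebra_simps flip: fps_const_add fps_const_mult)
  show "differential_algebra (\<lambda>c f. fps_const (c::complex) * f) euler_op"
    by standard (simp_all add: euler_op_def algebra_simps)
qed

lemma fps_nth_euler_op: "fps_nth (euler_op f) n = of_nat n * fps_nth f n"
  by (cases n) (simp_all add: euler_op_def)

lemma fps_nth_euler_op_funpow: "fps_nth ((euler_op ^^ s) f) n = of_nat n ^ s * fps_nth f n"
  by (induction s) (simp_all add: fps_nth_euler_op mult.assoc)

lemma fps_nth_lambda_fps_mult: "fps_nth (lambda_fps * f) n = (\<Sum>j<n. fps_nth f j)"
proof -
  have "lambda_fps * f = fps_X * (f / (1 - fps_X))"
    by (simp add: lambda_fps_def fps_divide_unit mult_ac)
  then show ?thesis
    by (cases n) (simp_all add: fps_divide_fps_X_minus1_sum atLeast0AtMost lessThan_Suc_atMost)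
qed

fun Li_fps :: "nat list \<Rightarrow> 'a::field fps" where
  "Li_fps [] = 1"
| "Li_fps (a # s) = (euler_op ^^ a) (lambda_fps * Li_fps s)"

lemma Li_fps_ywords:
  "Li_fps (ywords n (w @ [X1])) = (euler_op ^^ n) (euler.word_act w lambda_fps)"
proof (induction w arbitrary: n)
  case (Cons a w)
  then show ?case by (cases a) (simp_all add: funpow_swap1)
qed simp

lemma linear_extension_pi_Y:
  "euler.linear_extension \<phi> (pi_Y p) = euler.linear_extension (\<lambda>w. \<phi> (ywords 0 w)) p"
  unfolding pi_Y_def euler.linear_extension_sum euler.linear_extension_single
  by (simp add: euler.linear_extension_def)

lemma linear_extension_Li_fps_pi_Y:
  "euler.linear_extension Li_fps (pi_Y (p * x1)) = euler.alg_act p lambda_fps"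
  by (simp add: linear_extension_pi_Y x1_def euler.linear_extension_mult_single plus_list_def
      Li_fps_ywords euler.alg_act_def)

section \<open>Convergence and the kernel\<close>

lemma fps_conv_radius_euler_op:
  fixes f :: "'a::{banach,real_normed_field} fps"
  shows "fps_conv_radius (euler_op f) \<ge> fps_conv_radius f"
proof -
  have "fps_conv_radius f \<le> fps_conv_radius (fps_deriv f)"
    by (rule fps_conv_radius_deriv)
  also have "\<dots> \<le> fps_conv_radius (euler_op f)"
    unfolding euler_op_def using fps_conv_radius_mult [of fps_X "fps_deriv f"] by simp
  finally show ?thesis .
qed

lemma fps_conv_radius_euler_op_funpow:
  fixes f :: "'a::{banach,real_normed_field} fps"
  shows "fps_conv_radius ((euler_op ^^ n) f) \<ge> fps_conv_radius f"
  by (induction n) (auto intro: order_trans fps_conv_radius_euler_op)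

lemma fps_conv_radius_lambda_fps:
  "fps_conv_radius (lambda_fps :: 'a::{banach,real_normed_field} fps) = 1"
proof -
  have "fps_nth (lambda_fps :: 'a fps) n = 1" if "n > 0" for n
    using that fps_nth_lambda_fps_mult [of 1 n] by (simp add: if_distrib sum.delta)
  then have "conv_radius (fps_nth (lambda_fps :: 'a fps)) = conv_radius (\<lambda>_. 1 :: 'a)"
    by (intro conv_radius_cong eventually_mono [OF eventually_gt_at_top [of 0]]) simp
  also have "\<dots> = 1"
    using conv_radius_ratio_limit [of 1 1 "\<lambda>_. 1 :: 'a"] by simp
  finally show ?thesis
    by (simp add: fps_conv_radius_def)
qed

lemma fps_conv_radius_Li_fps:
  "fps_conv_radius (Li_fps s :: 'a::{banach,real_normed_field} fps) \<ge> 1"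
proof (induction s)
  case (Cons a s)
  have "1 \<le> fps_conv_radius (lambda_fps * Li_fps s :: 'a fps)"
    using Cons.IH fps_conv_radius_mult [of lambda_fps "Li_fps s :: 'a fps"]
    by (simp add: fps_conv_radius_lambda_fps)
  also have "\<dots> \<le> fps_conv_radius (Li_fps (a # s) :: 'a fps)"
    by (simp add: fps_conv_radius_euler_op_funpow)
  finally show ?case .
qed simp

text \<open>The empty tuple has leading index \<open>0\<close>, which makes the recursion on the length uniform.\<close>

fun leading_index :: "nat list \<Rightarrow> nat" where
  "leading_index [] = 0"
| "leading_index (n # ns) = n"

definition leading_index_tuples :: "nat \<Rightarrow> nat \<Rightarrow> nat list set" where
  "leading_index_tuples m n = {ns \<in> index_tuples m. leading_index ns = n}"

definition tuple_weight :: "nat list \<Rightarrow> nat list \<Rightarrow> nat" where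
  "tuple_weight s ns = (\<Prod>i<length s. (ns ! i) ^ (s ! i))"

lemma tuple_weight_Cons: "tuple_weight (a # s) (n # ns) = n ^ a * tuple_weight s ns"
  by (simp add: tuple_weight_def prod.lessThan_Suc_shift del: prod.lessThan_Suc)

lemma index_tuples_0: "index_tuples 0 = {[]}"
  by (auto simp: index_tuples_def)

lemma Cons_in_index_tuples_Suc_iff:
  "n # ns \<in> index_tuples (Suc m) \<longleftrightarrow> ns \<in> index_tuples m \<and> leading_index ns < n"
  by (cases ns) (auto simp: index_tuples_def)

lemma leading_index_tuples_0: "leading_index_tuples 0 n = (if n = 0 then {[]} else {})"
  by (auto simp: leading_index_tuples_def index_tuples_0)

lemma leading_index_tuples_Suc:
  "leading_index_tuples (Suc m) n = (\<Union>j<n. (#) n ` leading_index_tuples m j)"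
proof (intro set_eqI)
  fix ns
  show "ns \<in> leading_index_tuples (Suc m) n \<longleftrightarrow> ns \<in> (\<Union>j<n. (#) n ` leading_index_tuples m j)"
  proof (cases ns)
    case Nil
    then show ?thesis by (auto simp: leading_index_tuples_def index_tuples_def)
  next
    case (Cons i js)
    then show ?thesis by (auto simp: leading_index_tuples_def Cons_in_index_tuples_Suc_iff)
  qed
qed

lemma finite_leading_index_tuples: "finite (leading_index_tuples m n)"
  by (induction m arbitrary: n) (simp_all add: leading_index_tuples_0 leading_index_tuples_Suc)

lemma fps_nth_Li_fps:
  "fps_nth (Li_fps s) n = of_nat (\<Sum>ns\<in>leading_index_tuples (length s) n. tuple_weight s ns)"
proof (induction s arbitrary: n)
  case Nil
  show ?case by (simp add: leading_index_tuples_0 tuple_weight_def)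
next
  case (Cons a s)
  let ?T = "leading_index_tuples (length s)"
  have "(\<Sum>ns\<in>leading_index_tuples (Suc (length s)) n. tuple_weight (a # s) ns) =
      (\<Sum>j<n. \<Sum>ns\<in>(#) n ` ?T j. tuple_weight (a # s) ns)"
    unfolding leading_index_tuples_Suc
    by (intro sum.UNION_disjoint)
      (auto simp: finite_leading_index_tuples, auto simp: leading_index_tuples_def)
  also have "\<dots> = n ^ a * (\<Sum>j<n. \<Sum>ns\<in>?T j. tuple_weight s ns)"
    by (simp add: sum.reindex tuple_weight_Cons sum_distrib_left)
  finally show ?case
    by (simp add: fps_nth_euler_op_funpow fps_nth_lambda_fps_mult Cons.IH)
qed

lemma sums_infsum_fibres:
  fixes f :: "'a \<Rightarrow> 'b::banach" and d :: "'a \<Rightarrow> nat"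
  assumes finite_fibre: "\<And>n. finite {x \<in> A. d x = n}"
    and summable_norm: "summable (\<lambda>n. \<Sum>x | x \<in> A \<and> d x = n. norm (f x))"
  shows "(\<lambda>n. \<Sum>x | x \<in> A \<and> d x = n. f x) sums (\<Sum>\<^sub>\<infinity>x\<in>A. f x)"
proof -
  define B where "B n = {x \<in> A. d x = n}" for n
  have bij: "bij_betw snd (Sigma UNIV B) A"
    by (auto simp: bij_betw_def inj_on_def B_def image_iff)
  have "(\<lambda>n. \<Sum>x\<in>B n. norm (f x)) summable_on UNIV"
    using summable_norm
    by (subst summable_on_UNIV_nonneg_real_iff) (simp_all add: B_def sum_nonneg)
  then have "(\<lambda>p. norm (f (snd p))) summable_on Sigma UNIV B"
    by (rule summable_on_SigmaI [rotated]) (simp_all add: B_def finite_fibre has_sum_finite)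
  then have "(\<lambda>x. norm (f x)) summable_on A"
    using summable_on_reindex_bij_betw [OF bij, of "\<lambda>x. norm (f x)"] by simp
  then have "(f has_sum infsum f A) A"
    by (rule has_sum_infsum [OF abs_summable_summable])
  then have "((\<lambda>p. f (snd p)) has_sum infsum f A) (Sigma UNIV B)"
    by (simp only: has_sum_reindex_bij_betw [OF bij])
  then have "((\<lambda>n. \<Sum>x\<in>B n. f x) has_sum infsum f A) UNIV"
    by (rule has_sum_SigmaD) (simp add: B_def finite_fibre has_sum_finite)
  then show ?thesis
    unfolding B_def by (rule has_sum_imp_sums)
qed

lemma Li_neg_eq_infsum_tuple_weight:
  "Li_neg s z =
    (\<Sum>\<^sub>\<infinity>ns\<in>index_tuples (length s). of_nat (tuple_weight s ns) * z ^ leading_index ns)"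
proof (cases "s = []")
  case True
  then show ?thesis by (simp add: Li_neg_def index_tuples_0 tuple_weight_def)
next
  case False
  have "hd ns = leading_index ns" if "ns \<in> index_tuples (length s)" for ns
    using that False by (cases ns) (auto simp: index_tuples_def)
  then show ?thesis
    using False by (auto simp: Li_neg_def tuple_weight_def intro!: infsum_cong)
qed

lemma sums_Li_neg:
  assumes "norm z < 1"
  shows "(\<lambda>n. fps_nth (Li_fps s) n * z ^ n) sums Li_neg s z"
proof -
  let ?T = "\<lambda>n. {ns \<in> index_tuples (length s). leading_index ns = n}"
  let ?f = "\<lambda>ns. of_nat (tuple_weight s ns) * z ^ leading_index ns"
  have sum_fibre: "(\<Sum>ns\<in>?T n. ?f ns) = fps_nth (Li_fps s) n * z ^ n" for n
    by (simp add: fps_nth_Li_fps leading_index_tuples_def sum_distrib_right)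
  have sum_norm_fibre: "(\<Sum>ns\<in>?T n. norm (?f ns)) = norm (fps_nth (Li_fps s) n * z ^ n)" for n
    by (simp add: fps_nth_Li_fps leading_index_tuples_def norm_mult norm_power sum_distrib_right
        del: of_nat_sum) (simp add: sum_distrib_right)
  have "ereal (norm z) < fps_conv_radius (Li_fps s :: complex fps)"
    using assms by (intro less_le_trans [OF _ fps_conv_radius_Li_fps]) simp
  then have "summable (\<lambda>n. norm (fps_nth (Li_fps s) n * z ^ n))"
    by (rule norm_summable_fps)
  then have "(\<lambda>n. \<Sum>ns\<in>?T n. ?f ns) sums (\<Sum>\<^sub>\<infinity>ns\<in>index_tuples (length s). ?f ns)"
    using finite_leading_index_tuples
    by (intro sums_infsum_fibres) (simp_all only: sum_norm_fibre leading_index_tuples_def)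
  then show ?thesis
    by (simp only: sum_fibre Li_neg_eq_infsum_tuple_weight)
qed

lemma sums_Li_neg_map:
  assumes "norm z < 1"
  shows "(\<lambda>n. fps_nth (euler.linear_extension Li_fps p) n * z ^ n) sums Li_neg_map p z"
  unfolding Li_neg_map_def euler.linear_extension_def
    fps_sum_nth sum_distrib_right fps_mult_left_const_nth mult.assoc
  by (intro sums_sum sums_mult sums_Li_neg assms)

lemma Ker_Li_negI:
  assumes "euler.linear_extension Li_fps p = 0"
  shows "p \<in> Ker_Li_neg"
proof -
  have "Li_neg_map p z = 0" if "norm z < 1" for z
    using sums_Li_neg_map [OF that, of p] by (simp add: assms sums_iff)
  then show ?thesis
    by (simp add: Ker_Li_neg_def)
qed

theorem theorem6p1:
  fixes r :: nat and k :: "nat \<Rightarrow> nat" and \<sigma> :: "nat \<Rightarrow> nat"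
  assumes "r > 0" and "\<sigma> permutes {1..r}"
  shows "pi_Y ((magnus r k - magnus r (k \<circ> \<sigma>)) * x1) \<in> Ker_Li_neg"
proof (rule Ker_Li_negI)
  have "euler.alg_act (magnus r k - magnus r (k \<circ> \<sigma>)) lambda_fps = 0"
    by (simp add: euler.alg_act_diff euler.alg_act_magnus_permute [OF assms])
  then show "euler.linear_extension Li_fps (pi_Y ((magnus r k - magnus r (k \<circ> \<sigma>)) * x1)) = 0"
    by (simp only: linear_extension_Li_fps_pi_Y)
qed

end
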